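(* Let $\mathcal{V}$ be a finite-dimensional real vector space, let $\mathbf{P_1}$ and $\mathbf{P_2}$ be independent random vectors in $\mathcal{V}$ with finite support, and let $\mathbf{C_1}$ and $\mathbf{C_2}$ be surveys of $\mathbf{P_1}$ and $\mathbf{P_2}$ respectively. Let $p\in[0,1]$. Let $\mathbf{P}$ be the random vector equal to $\mathbf{P_1}$ with probability $p$ and to $\mathbf{P_2}$ with probability $1-p$, and let $\mathbf{C}$ be equal to $\mathbf{C_1}$ with probability $p$ and to $\mathbf{C_2}$ with probability $1-p$. Then $\mathbf{C}$ is a survey of $\mathbf{P}$.
   Context: A skeleton in $\mathcal{V}$ is a tuple $(\mathcal{S},\alpha_1,\dots,\alpha_n)$ where $\mathcal{S}=(S_1,\dots,S_n)$ is a finite sequence of elements of $\mathcal{V}$ (the base set) and $\alpha_1,\dots,\alpha_n$ are functions from the convex hull $\mathrm{conv}(\mathcal{S})$ to $[0,1]$ such that for every $\eta\in\mathrm{conv}(\mathcal{S})$: $\sum_{i=1}^n\alpha_i(\eta)=1$ and $\eta=\sum_{i=1}^n\alpha_i(\eta)S_i$. If $\mathbf{P}$ is a random vector in $\mathcal{V}$ with finite support contained in $\mathrm{conv}(\mathcal{S})$, a survey of $\mathbf{P}$ on this skeleton is a random element $\mathbf{C}$ of $\mathcal{S}$ with $\mathbb{P}(\mathbf{C}=S_i)=\mathbb{E}[\alpha_i(\mathbf{P})]$ for $i=1,\dots,n$. $\mathbf{A}$ is called a survey of $\mathbf{B}$ if there exists some skeleton on which $\mathbf{A}$ is a survey of $\mathbf{B}$.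 *)

theory Defs
  imports "HOL-Probability.Probability"
begin

text \<open>
  The sequence \<^term>\<open>S\<close> is indexed from 0. The functions \<^term>\<open>\<alpha>\<close> are total,
  but only their values on the convex hull of the base set are constrained.
\<close>

definition skeleton :: "'v::real_vector list \<Rightarrow> (nat \<Rightarrow> 'v \<Rightarrow> real) \<Rightarrow> bool" where
  "skeleton S \<alpha> \<longleftrightarrow>
     (\<forall>\<eta> \<in> convex hull (set S).
        (\<forall>i<length S. \<alpha> i \<eta> \<in> {0..1}) \<and>
        (\<Sum>i<length S. \<alpha> i \<eta>) = 1 \<and>
        \<eta> = (\<Sum>i<length S. \<alpha> i \<eta> *\<^sub>R S ! i))"

text \<open>
  Random vectors with finite support are discrete, so the target space carries the
  discrete sigma-algebra. The functions of a skeleton need not be Borel measurable, and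
  with this choice their composition with such a random vector is still measurable, so
  that the Bochner integral in \<open>survey_on\<close> is the intended expectation (it would be 0 by
  convention for a non-measurable integrand).
\<close>

definition finitely_supported :: "'a measure \<Rightarrow> ('a \<Rightarrow> 'v) \<Rightarrow> bool" where
  "finitely_supported M X \<longleftrightarrow>
     X \<in> M \<rightarrow>\<^sub>M count_space UNIV \<and> (\<exists>F. finite F \<and> (AE \<omega> in M. X \<omega> \<in> F))"

definition survey_on ::
  "'a measure \<Rightarrow> 'v::real_vector list \<Rightarrow> (nat \<Rightarrow> 'v \<Rightarrow> real) \<Rightarrow> ('a \<Rightarrow> 'v) \<Rightarrow> ('a \<Rightarrow> 'v) \<Rightarrow> bool" where
  "survey_on M S \<alpha> C P \<longleftrightarrow>
     skeleton S \<alpha> \<and>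
     finitely_supported M P \<and> (AE \<omega> in M. P \<omega> \<in> convex hull (set S)) \<and>
     C \<in> M \<rightarrow>\<^sub>M count_space (set S) \<and>
     (\<forall>i<length S. measure M {\<omega> \<in> space M. C \<omega> = S ! i} = (\<integral>\<omega>. \<alpha> i (P \<omega>) \<partial>M))"

definition survey :: "'a measure \<Rightarrow> ('a \<Rightarrow> 'v::real_vector) \<Rightarrow> ('a \<Rightarrow> 'v) \<Rightarrow> bool" where
  "survey M C P \<longleftrightarrow> (\<exists>S \<alpha>. survey_on M S \<alpha> C P)"

text \<open>
  \<^term>\<open>Z\<close> equals \<^term>\<open>X\<close> with probability \<^term>\<open>p\<close> and \<^term>\<open>Y\<close> with probability
  \<open>1 - p\<close>: the choice is made by an event \<^term>\<open>A\<close> of probability \<^term>\<open>p\<close> that is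
  independent of the pair of \<^term>\<open>X\<close> and \<^term>\<open>Y\<close>. The constant \<open>indep_var\<close> does not
  apply, as it wants both random variables to take values in the same type.
\<close>

definition mixture_of :: "'a measure \<Rightarrow> real \<Rightarrow> ('a \<Rightarrow> 'v) \<Rightarrow> ('a \<Rightarrow> 'v) \<Rightarrow> ('a \<Rightarrow> 'v) \<Rightarrow> bool" where
  "mixture_of M p X Y Z \<longleftrightarrow>
     (\<exists>A \<in> sets M.
        prob_space.indep_set M {A}
          {(\<lambda>\<omega>. (X \<omega>, Y \<omega>)) -` D \<inter> space M | D.
             D \<in> sets (count_space UNIV \<Otimes>\<^sub>M count_space UNIV)} \<and>
        measure M A = p \<and>
        (\<forall>\<omega> \<in> space M. Z \<omega> = (if \<omega> \<in> A then X \<omega> else Y \<omega>)))"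

end

theory Submission imports Defs begin

text \<open>
  Whether \<open>C\<close> is a survey of \<open>P\<close> depends only on the two distributions, and both are mixtures.
  So it is enough to find, on the union of the two base sets, weights whose expectation under \<open>P\<close>
  is the mixture of the given expectations. At a point \<open>\<eta>\<close> of positive mass, average the two
  given weights in proportion to \<open>p * P(P1 = \<eta>)\<close> and \<open>(1 - p) * P(P2 = \<eta>)\<close>; at the other
  points of the hull the weights have no influence and are arbitrary convex coefficients.
\<close>

section \<open>Convex coefficients over a finite set\<close>

text \<open>This is one value of a skeleton, with coefficients indexed by base elements rather than
  positions, so that coefficients over different base sets can be compared and added on their union.
  Fixing \<open>\<eta>\<close> allows a separate choice at each point of the hull.\<close>

definition convex_weights :: "'v::real_vector set \<Rightarrow> ('v \<Rightarrow> real) \<Rightarrow> 'v \<Rightarrow> bool" where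
  "convex_weights T w \<eta> \<longleftrightarrow> (\<forall>s\<in>T. 0 \<le> w s) \<and> sum w T = 1 \<and> (\<Sum>s\<in>T. w s *\<^sub>R s) = \<eta>"

lemma ex_convex_weights:
  assumes "finite T" "\<eta> \<in> convex hull T"
  shows "\<exists>w. convex_weights T w \<eta>"
  using assms by (auto simp: convex_hull_finite convex_weights_def)

lemma convex_weights_mono:
  assumes "convex_weights T w \<eta>" "finite U" "T \<subseteq> U" "\<And>s. s \<notin> T \<Longrightarrow> w s = 0"
  shows "convex_weights U w \<eta>"
proof -
  have "sum w U = sum w T" "(\<Sum>s\<in>U. w s *\<^sub>R s) = (\<Sum>s\<in>T. w s *\<^sub>R s)"
    using assms by (auto intro!: sum.mono_neutral_right)
  moreover have "0 \<le> w s" for s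
    using assms(1,4) by (cases "s \<in> T") (auto simp: convex_weights_def)
  ultimately show ?thesis
    using assms(1) by (simp add: convex_weights_def)
qed

text \<open>The conditions for \<open>a\<close> and \<open>b\<close> form a convex set. Each is
  assumed only when its factor is nonzero: a point of zero mass for one vector may lie outside the
  corresponding hull, where its coefficients are unconstrained, and the zero factor then removes
  them.\<close>

lemma convex_weights_average:
  fixes u v :: real
  assumes "u \<noteq> 0 \<Longrightarrow> convex_weights T a \<eta>" "v \<noteq> 0 \<Longrightarrow> convex_weights T b \<eta>"
    and "0 \<le> u" "0 \<le> v" "u + v \<noteq> 0"
  shows "convex_weights T (\<lambda>s. (u * a s + v * b s) / (u + v)) \<eta>"
proof -
  have a: "u * sum a T = u" "u *\<^sub>R (\<Sum>s\<in>T. a s *\<^sub>R s) = u *\<^sub>R \<eta>" "\<And>s. s \<in> T \<Longrightarrow> 0 \<le> u * a s"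
    using assms(1,3) by (cases "u = 0"; simp add: convex_weights_def)+
  have b: "v * sum b T = v" "v *\<^sub>R (\<Sum>s\<in>T. b s *\<^sub>R s) = v *\<^sub>R \<eta>" "\<And>s. s \<in> T \<Longrightarrow> 0 \<le> v * b s"
    using assms(2,4) by (cases "v = 0"; simp add: convex_weights_def)+
  have "(\<Sum>s\<in>T. (u * a s + v * b s) / (u + v)) = (u * sum a T + v * sum b T) / (u + v)"
    by (simp add: sum_divide_distrib[symmetric] sum.distrib sum_distrib_left)
  also have "\<dots> = 1"
    unfolding a(1) b(1) using assms(5) by simp
  finally have *: "(\<Sum>s\<in>T. (u * a s + v * b s) / (u + v)) = 1" .
  have "(\<Sum>s\<in>T. ((u * a s + v * b s) / (u + v)) *\<^sub>R s)
      = (1 / (u + v)) *\<^sub>R (u *\<^sub>R (\<Sum>s\<in>T. a s *\<^sub>R s) + v *\<^sub>R (\<Sum>s\<in>T. b s *\<^sub>R s))"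
    by (simp add: scaleR_sum_right sum.distrib[symmetric] scaleR_left_distrib scaleR_right_distrib
        add_divide_distrib)
  also have "\<dots> = \<eta>"
    unfolding a(2) b(2) using assms(5) by (simp add: scaleR_left_distrib[symmetric])
  finally show ?thesis
    using * a(3) b(3) assms(3,4) by (auto simp: convex_weights_def)
qed

section \<open>Random elements with finite support\<close>

lemma finitely_supported_vimage_sets:
  assumes "finitely_supported M X"
  shows "{\<omega> \<in> space M. X \<omega> = x} \<in> sets M"
proof -
  have "X -` {x} \<inter> space M \<in> sets M"
    using assms by (auto simp: finitely_supported_def intro: measurable_sets)
  also have "X -` {x} \<inter> space M = {\<omega> \<in> space M. X \<omega> = x}"
    by auto
  finally show ?thesis .
qed

lemma measurable_count_space_mono:
  assumes "X \<in> M \<rightarrow>\<^sub>M count_space A" "A \<subseteq> B"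
  shows "X \<in> M \<rightarrow>\<^sub>M count_space B"
  using measurable_compose[OF assms(1), of "\<lambda>x. x" "count_space B"] assms(2) by auto

lemma finitely_supported_count_space:
  assumes "X \<in> M \<rightarrow>\<^sub>M count_space T" "finite T"
  shows "finitely_supported M X"
proof -
  have "X \<in> M \<rightarrow>\<^sub>M count_space UNIV"
    using assms(1) by (rule measurable_count_space_mono) simp
  moreover have "AE \<omega> in M. X \<omega> \<in> T"
    using measurable_space[OF assms(1)] by auto
  ultimately show ?thesis
    using assms(2) by (auto simp: finitely_supported_def)
qed

context prob_space
begin

text \<open>Almost everywhere \<open>f (X \<omega>)\<close> is a finite combination of indicators of
  the level sets of \<open>X\<close>. An arbitrary \<open>f\<close> is allowed because the target of
  \<open>X\<close> is discrete; this matters since skeleton functions may be far from Borel.\<close>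

lemma finitely_supported_expectation:
  fixes f :: "'v \<Rightarrow> real"
  assumes X: "finitely_supported M X" and F: "finite F" "AE \<omega> in M. X \<omega> \<in> F"
  shows "integrable M (\<lambda>\<omega>. f (X \<omega>))"
    and "expectation (\<lambda>\<omega>. f (X \<omega>)) = (\<Sum>x\<in>F. f x * prob {\<omega> \<in> space M. X \<omega> = x})"
proof -
  let ?g = "\<lambda>\<omega>. \<Sum>x\<in>F. f x * indicator {\<omega> \<in> space M. X \<omega> = x} \<omega> :: real"
  note sets = finitely_supported_vimage_sets[OF X]
  have int: "integrable M (\<lambda>\<omega>. f x * indicator {\<omega> \<in> space M. X \<omega> = x} \<omega> :: real)" for x
    using sets by (intro integrable_mult_right integrable_real_indicator) (auto simp: emeasure_eq_measure)
  have meas: "(\<lambda>\<omega>. f (X \<omega>)) \<in> borel_measurable M"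
    using X measurable_compose[of X M "count_space UNIV" f borel]
    by (simp add: finitely_supported_def)
  have g: "integrable M ?g"
    using int by (intro Bochner_Integration.integrable_sum) auto
  have eq: "AE \<omega> in M. ?g \<omega> = f (X \<omega>)"
    using F(2) AE_space
  proof eventually_elim
    case (elim \<omega>)
    then have "?g \<omega> = (\<Sum>x\<in>F. if x = X \<omega> then f x else 0)"
      by (intro sum.cong) auto
    then show ?case
      using elim F(1) by simp
  qed
  show "integrable M (\<lambda>\<omega>. f (X \<omega>))"
    using integrable_cong_AE_imp[OF g meas eq] .
  have "expectation (\<lambda>\<omega>. f (X \<omega>)) = expectation ?g"
    using integral_cong_AE[OF borel_measurable_integrable[OF g] meas eq] by simp
  also have "\<dots> = (\<Sum>x\<in>F. expectation (\<lambda>\<omega>. f x * indicator {\<omega> \<in> space M. X \<omega> = x} \<omega>))"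
    using int by (intro Bochner_Integration.integral_sum) auto
  also have "\<dots> = (\<Sum>x\<in>F. f x * prob {\<omega> \<in> space M. X \<omega> = x})"
    using sets by (intro sum.cong) (auto simp: Int_absorb2 sets.sets_into_space)
  finally show "expectation (\<lambda>\<omega>. f (X \<omega>)) = (\<Sum>x\<in>F. f x * prob {\<omega> \<in> space M. X \<omega> = x})" .
qed

lemma AE_prob_nonzero:
  assumes "AE \<omega> in M. X \<omega> \<in> Q" "prob {\<omega> \<in> space M. X \<omega> = x} \<noteq> 0"
  shows "x \<in> Q"
proof (rule ccontr)
  assume "x \<notin> Q"
  then have "AE \<omega> in M. \<omega> \<notin> {\<omega> \<in> space M. X \<omega> = x}"
    using assms(1) by (auto elim!: eventually_mono)
  \<comment> \<open>A level set outside the sigma-algebra has measure 0 by convention, so both cases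
    give 0.\<close>
  then have "prob {\<omega> \<in> space M. X \<omega> = x} = 0"
    using AE_iff_measurable[of "{\<omega> \<in> space M. X \<omega> = x}" M "\<lambda>\<omega>. \<omega> \<notin> {\<omega> \<in> space M. X \<omega> = x}"]
    by (cases "{\<omega> \<in> space M. X \<omega> = x} \<in> sets M") (auto simp: measure_def emeasure_notin_sets)
  then show False
    using assms(2) by simp
qed

text \<open>The event \<open>Z = z\<close> is the disjoint union of \<open>X = z\<close> inside
  \<open>A\<close> and \<open>Y = z\<close> outside \<open>A\<close>. Both \<open>X = z\<close> and
  \<open>Y = z\<close> are preimages of strips under the pair, hence independent of
  \<open>A\<close>. The event \<open>A\<close> is returned as well because measurability and almost
  sure bounds for \<open>Z\<close> are later read off from the case distinction.\<close>

lemma mixture_ofE: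
  assumes mix: "mixture_of M p X Y Z"
    and X: "finitely_supported M X" and Y: "finitely_supported M Y"
  obtains A where "A \<in> events" "\<And>\<omega>. \<omega> \<in> space M \<Longrightarrow> Z \<omega> = (if \<omega> \<in> A then X \<omega> else Y \<omega>)"
    "\<And>z. prob {\<omega> \<in> space M. Z \<omega> = z} =
      p * prob {\<omega> \<in> space M. X \<omega> = z} + (1 - p) * prob {\<omega> \<in> space M. Y \<omega> = z}"
proof -
  obtain A where A: "A \<in> events"
    and ind: "indep_set {A} {(\<lambda>\<omega>. (X \<omega>, Y \<omega>)) -` D \<inter> space M | D.
             D \<in> sets (count_space UNIV \<Otimes>\<^sub>M count_space UNIV)}"
    and p: "prob A = p"
    and Z: "\<And>\<omega>. \<omega> \<in> space M \<Longrightarrow> Z \<omega> = (if \<omega> \<in> A then X \<omega> else Y \<omega>)"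
    using mix unfolding mixture_of_def by auto
  have "prob {\<omega> \<in> space M. Z \<omega> = z} =
      p * prob {\<omega> \<in> space M. X \<omega> = z} + (1 - p) * prob {\<omega> \<in> space M. Y \<omega> = z}" for z
  proof -
    let ?X = "{\<omega> \<in> space M. X \<omega> = z}" and ?Y = "{\<omega> \<in> space M. Y \<omega> = z}"
    have XY: "?X \<in> events" "?Y \<in> events"
      using X Y by (auto intro: finitely_supported_vimage_sets)
    have "prob (A \<inter> ?X) = prob A * prob ?X"
      by (rule indep_setD[OF ind]) (auto intro!: exI[of _ "{z} \<times> UNIV"])
    moreover have "prob (A \<inter> ?Y) = prob A * prob ?Y"
      by (rule indep_setD[OF ind]) (auto intro!: exI[of _ "UNIV \<times> {z}"])
    moreover have "prob (?Y - A) = prob ?Y - prob (A \<inter> ?Y)"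
      using finite_measure_Diff'[OF XY(2) A] by (simp add: Int_commute)
    moreover have "{\<omega> \<in> space M. Z \<omega> = z} = (A \<inter> ?X) \<union> (?Y - A)"
      using Z sets.sets_into_space[OF A] by (auto split: if_splits)
    moreover have "prob ((A \<inter> ?X) \<union> (?Y - A)) = prob (A \<inter> ?X) + prob (?Y - A)"
      using A XY by (intro finite_measure_Union) auto
    ultimately show ?thesis
      using p by (simp add: algebra_simps)
  qed
  with A Z show ?thesis
    by (intro that) auto
qed

section \<open>Between surveys and weights indexed by base elements\<close>

text \<open>
  If an element \<open>s\<close> occurs \<open>N s\<close> times in the sequence, then the expectations of its weights add up
  to \<open>N s * P(C = s)\<close>. Summing over \<open>s\<close> gives 1, which forces \<open>P(C = s) = 0\<close> whenever
  \<open>N s > 1\<close>. So the weights of repeated elements can be merged.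
\<close>

lemma survey_imp_weights:
  fixes C P :: "'a \<Rightarrow> 'v::real_vector"
  assumes "survey M C P"
  obtains T a where "finite T" "\<And>\<eta>. \<eta> \<in> convex hull T \<Longrightarrow> convex_weights T (\<lambda>s. a s \<eta>) \<eta>"
    "\<And>s \<eta>. s \<notin> T \<Longrightarrow> a s \<eta> = 0"
    "finitely_supported M P" "AE \<omega> in M. P \<omega> \<in> convex hull T" "C \<in> M \<rightarrow>\<^sub>M count_space T"
    "\<And>s. prob {\<omega> \<in> space M. C \<omega> = s} = expectation (\<lambda>\<omega>. a s (P \<omega>))"
proof -
  obtain S \<alpha> where sk: "skeleton S \<alpha>" and P: "finitely_supported M P"
    and hull: "AE \<omega> in M. P \<omega> \<in> convex hull (set S)"
    and C: "C \<in> M \<rightarrow>\<^sub>M count_space (set S)"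
    and prob: "\<And>i. i < length S \<Longrightarrow> prob {\<omega> \<in> space M. C \<omega> = S ! i} = expectation (\<lambda>\<omega>. \<alpha> i (P \<omega>))"
    using assms unfolding survey_def survey_on_def by auto
  \<comment> \<open>\<open>I s\<close> collects the positions holding \<open>s\<close>, so its
    cardinality is the \<open>N s\<close> above; \<open>a s\<close> is the merged weight.\<close>
  define I where "I s = {i \<in> {..<length S}. S ! i = s}" for s
  define a where "a s \<eta> = (\<Sum>i\<in>I s. \<alpha> i \<eta>)" for s \<eta>
  define q where "q s = prob {\<omega> \<in> space M. C \<omega> = s}" for s
  \<comment> \<open>Polymorphic in the summands, since it regroups both the real weights and the
    weighted vectors.\<close>
  have group: "(\<Sum>s\<in>set S. sum h (I s)) = (\<Sum>i<length S. h i)"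
    for h :: "nat \<Rightarrow> 'c::comm_monoid_add"
    unfolding I_def by (rule sum.group) auto
  have weights: "convex_weights (set S) (\<lambda>s. a s \<eta>) \<eta>" if "\<eta> \<in> convex hull (set S)" for \<eta>
  proof -
    have \<eta>: "\<And>i. i < length S \<Longrightarrow> 0 \<le> \<alpha> i \<eta>" "(\<Sum>i<length S. \<alpha> i \<eta>) = 1"
      "\<eta> = (\<Sum>i<length S. \<alpha> i \<eta> *\<^sub>R S ! i)"
      using sk that unfolding skeleton_def by auto
    have "a s \<eta> *\<^sub>R s = (\<Sum>i\<in>I s. \<alpha> i \<eta> *\<^sub>R S ! i)" for s
      unfolding a_def scaleR_sum_left by (intro sum.cong) (auto simp: I_def)
    then have "(\<Sum>s\<in>set S. a s \<eta> *\<^sub>R s) = \<eta>"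
      using \<eta>(3) by (simp add: group)
    moreover have "(\<Sum>s\<in>set S. a s \<eta>) = 1"
      using \<eta>(2) by (simp add: a_def group)
    moreover have "0 \<le> a s \<eta>" for s
      unfolding a_def using \<eta>(1) by (intro sum_nonneg) (auto simp: I_def)
    ultimately show ?thesis
      by (simp add: convex_weights_def)
  qed
  have I_empty: "I s = {}" if "s \<notin> set S" for s
    using that by (auto simp: I_def)
  obtain F where F: "finite F" "AE \<omega> in M. P \<omega> \<in> F"
    using P by (auto simp: finitely_supported_def)
  note integrable = finitely_supported_expectation(1)[OF P F]
  have exp_a: "expectation (\<lambda>\<omega>. a s (P \<omega>)) = card (I s) * q s" for s
  proof -
    have "expectation (\<lambda>\<omega>. a s (P \<omega>)) = (\<Sum>i\<in>I s. expectation (\<lambda>\<omega>. \<alpha> i (P \<omega>)))"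
      unfolding a_def using integrable by (intro Bochner_Integration.integral_sum) auto
    also have "\<dots> = (\<Sum>i\<in>I s. q s)"
      using prob by (intro sum.cong) (auto simp: I_def q_def)
    finally show ?thesis
      by simp
  qed
  have "(\<Sum>s\<in>set S. card (I s) * q s) = expectation (\<lambda>\<omega>. \<Sum>s\<in>set S. a s (P \<omega>))"
    unfolding exp_a[symmetric] using integrable
    by (intro Bochner_Integration.integral_sum[symmetric]) auto
  also have "\<dots> = expectation (\<lambda>_. 1)"
  proof (rule integral_cong_AE)
    show "(\<lambda>\<omega>. \<Sum>s\<in>set S. a s (P \<omega>)) \<in> borel_measurable M"
      using integrable by (intro borel_measurable_sum borel_measurable_integrable) auto
    show "AE \<omega> in M. (\<Sum>s\<in>set S. a s (P \<omega>)) = 1"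
      using hull weights by (auto simp: convex_weights_def elim!: eventually_mono)
  qed auto
  \<comment> \<open>The constant 1 is now integrated as a function of \<open>C\<close>, which gives
    the total mass of \<open>C\<close> over its finite range.\<close>
  also have "\<dots> = (\<Sum>s\<in>set S. q s)"
    using finitely_supported_expectation(2)[of C "set S" "\<lambda>_. 1"]
      finitely_supported_count_space[OF C] measurable_space[OF C] by (auto simp: q_def)
  finally have "(\<Sum>s\<in>set S. (real (card (I s)) - 1) * q s) = 0"
    by (simp add: left_diff_distrib sum_subtractf)
  \<comment> \<open>Every element of \<open>set S\<close> occupies at least one position, so no term
    is negative and the zero sum makes each term vanish.\<close>
  moreover have "(real (card (I s)) - 1) * q s \<ge> 0" if "s \<in> set S" for s
  proof -
    have "card (I s) \<noteq> 0"
      using that by (auto simp: I_def in_set_conv_nth)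
    then show ?thesis
      by (simp add: q_def)
  qed
  ultimately have *: "(real (card (I s)) - 1) * q s = 0" if "s \<in> set S" for s
    using that sum_nonneg_eq_0_iff[of "set S" "\<lambda>s. (real (card (I s)) - 1) * q s"] by auto
  \<comment> \<open>On the base set the vanishing term says \<open>card (I s) * q s = q s\<close>;
    off it both sides are 0.\<close>
  have "q s = expectation (\<lambda>\<omega>. a s (P \<omega>))" for s
  proof (cases "s \<in> set S")
    case True
    then show ?thesis
      using *[of s] by (auto simp: exp_a)
  next
    case False
    then have empty: "{\<omega> \<in> space M. C \<omega> = s} = {}"
      using measurable_space[OF C] by auto
    show ?thesis
      unfolding q_def empty using False by (simp add: exp_a I_empty)
  qed
  then show ?thesis
    using weights P hull C I_empty by (intro that[of "set S" a]) (auto simp: q_def a_def)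
qed

text \<open>Listing \<open>T\<close> without repetition makes positions and elements correspond one
  to one, so weights indexed by elements become a skeleton by reindexing.\<close>

lemma weights_imp_survey:
  fixes C P :: "'a \<Rightarrow> 'v::real_vector"
  assumes T: "finite T" and w: "\<And>\<eta>. \<eta> \<in> convex hull T \<Longrightarrow> convex_weights T (\<lambda>s. a s \<eta>) \<eta>"
    and P: "finitely_supported M P" "AE \<omega> in M. P \<omega> \<in> convex hull T"
    and C: "C \<in> M \<rightarrow>\<^sub>M count_space T"
    and prob: "\<And>s. s \<in> T \<Longrightarrow> prob {\<omega> \<in> space M. C \<omega> = s} = expectation (\<lambda>\<omega>. a s (P \<omega>))"
  shows "survey M C P"
proof -
  obtain S where S: "set S = T" "distinct S"
    using finite_distinct_list[OF T] by auto
  have reindex: "(\<Sum>i<length S. h (S ! i)) = sum h T" for h :: "'v \<Rightarrow> 'c::comm_monoid_add"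
    using bij_betw_nth[OF S(2) refl S(1)[symmetric]] by (rule sum.reindex_bij_betw)
  have "skeleton S (\<lambda>i. a (S ! i))"
    unfolding skeleton_def
  proof (intro ballI conjI allI impI)
    fix \<eta> assume "\<eta> \<in> convex hull (set S)"
    then have w': "\<And>s. s \<in> T \<Longrightarrow> 0 \<le> a s \<eta>" "(\<Sum>s\<in>T. a s \<eta>) = 1" "(\<Sum>s\<in>T. a s \<eta> *\<^sub>R s) = \<eta>"
      using w[of \<eta>] S by (auto simp: convex_weights_def)
    show "(\<Sum>i<length S. a (S ! i) \<eta>) = 1"
      using w'(2) reindex[of "\<lambda>s. a s \<eta>"] by simp
    show "\<eta> = (\<Sum>i<length S. a (S ! i) \<eta> *\<^sub>R S ! i)"
      using w'(3) reindex[of "\<lambda>s. a s \<eta> *\<^sub>R s"] by simp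
    fix i assume "i < length S"
    then have "S ! i \<in> T"
      using S by auto
    \<comment> \<open>A single nonnegative weight is at most the sum of all, which is 1.\<close>
    then show "a (S ! i) \<eta> \<in> {0..1}"
      using w' T member_le_sum[of "S ! i" T "\<lambda>s. a s \<eta>"] by auto
  qed
  then have "survey_on M S (\<lambda>i. a (S ! i)) C P"
    unfolding survey_on_def using P C prob S by auto
  then show ?thesis
    unfolding survey_def by blast
qed

section \<open>Mixing two surveys\<close>

lemma survey_mixture:
  fixes P1 P2 P C1 C2 C :: "'a \<Rightarrow> 'v::real_vector"
  assumes "survey M C1 P1" "survey M C2 P2" and p: "p \<in> {0..1}"
    and mixP: "mixture_of M p P1 P2 P" and mixC: "mixture_of M p C1 C2 C"
  shows "survey M C P"
proof -
  obtain T1 a where T1: "finite T1"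
    and a: "\<And>\<eta>. \<eta> \<in> convex hull T1 \<Longrightarrow> convex_weights T1 (\<lambda>s. a s \<eta>) \<eta>"
      "\<And>s \<eta>. s \<notin> T1 \<Longrightarrow> a s \<eta> = 0"
    and P1: "finitely_supported M P1" "AE \<omega> in M. P1 \<omega> \<in> convex hull T1"
    and C1: "C1 \<in> M \<rightarrow>\<^sub>M count_space T1"
    and prob1: "\<And>s. prob {\<omega> \<in> space M. C1 \<omega> = s} = expectation (\<lambda>\<omega>. a s (P1 \<omega>))"
    by (rule survey_imp_weights[OF assms(1)]) (rule that)
  obtain T2 b where T2: "finite T2"
    and b: "\<And>\<eta>. \<eta> \<in> convex hull T2 \<Longrightarrow> convex_weights T2 (\<lambda>s. b s \<eta>) \<eta>"
      "\<And>s \<eta>. s \<notin> T2 \<Longrightarrow> b s \<eta> = 0"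
    and P2: "finitely_supported M P2" "AE \<omega> in M. P2 \<omega> \<in> convex hull T2"
    and C2: "C2 \<in> M \<rightarrow>\<^sub>M count_space T2"
    and prob2: "\<And>s. prob {\<omega> \<in> space M. C2 \<omega> = s} = expectation (\<lambda>\<omega>. b s (P2 \<omega>))"
    by (rule survey_imp_weights[OF assms(2)]) (rule that)
  obtain F1 F2 where F: "finite F1" "AE \<omega> in M. P1 \<omega> \<in> F1" "finite F2" "AE \<omega> in M. P2 \<omega> \<in> F2"
    using P1(1) P2(1) unfolding finitely_supported_def by auto
  obtain A where A: "A \<in> events"
    and P: "\<And>\<omega>. \<omega> \<in> space M \<Longrightarrow> P \<omega> = (if \<omega> \<in> A then P1 \<omega> else P2 \<omega>)"
    and probP: "\<And>z. prob {\<omega> \<in> space M. P \<omega> = z} =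
      p * prob {\<omega> \<in> space M. P1 \<omega> = z} + (1 - p) * prob {\<omega> \<in> space M. P2 \<omega> = z}"
    by (rule mixture_ofE[OF mixP P1(1) P2(1)]) auto
  obtain B where B: "B \<in> events"
    and C: "\<And>\<omega>. \<omega> \<in> space M \<Longrightarrow> C \<omega> = (if \<omega> \<in> B then C1 \<omega> else C2 \<omega>)"
    and probC: "\<And>z. prob {\<omega> \<in> space M. C \<omega> = z} =
      p * prob {\<omega> \<in> space M. C1 \<omega> = z} + (1 - p) * prob {\<omega> \<in> space M. C2 \<omega> = z}"
    by (rule mixture_ofE[OF mixC finitely_supported_count_space[OF C1 T1]
          finitely_supported_count_space[OF C2 T2]]) auto
  define T where "T = T1 \<union> T2"
  \<comment> \<open>A common finite range lets the expectations under \<open>P1\<close>,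
    \<open>P2\<close> and \<open>P\<close> be sums over the same points.\<close>
  define F where "F = F1 \<union> F2"
  have T: "finite T" "T1 \<subseteq> T" "T2 \<subseteq> T" and finF: "finite F"
    using T1 T2 F by (auto simp: T_def F_def)
  note hull_mono = hull_mono[OF T(2), of convex] hull_mono[OF T(3), of convex]
  have AE_F: "AE \<omega> in M. P1 \<omega> \<in> F" "AE \<omega> in M. P2 \<omega> \<in> F"
    using F by (auto simp: F_def elim: eventually_mono)
  have AE_P: "AE \<omega> in M. P \<omega> \<in> F \<and> P \<omega> \<in> convex hull T"
    using AE_F P1(2) P2(2) AE_space
    by eventually_elim (use P hull_mono in auto)
  have "(\<lambda>\<omega>. if \<omega> \<in> A then P1 \<omega> else P2 \<omega>) \<in> M \<rightarrow>\<^sub>M count_space UNIV"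
    using A P1(1) P2(1) by (intro measurable_If_set) (auto simp: finitely_supported_def)
  then have "P \<in> M \<rightarrow>\<^sub>M count_space UNIV"
    using P by (simp cong: measurable_cong)
  then have Pfin: "finitely_supported M P"
    using finF AE_P by (auto simp: finitely_supported_def elim!: eventually_mono)
  have "(\<lambda>\<omega>. if \<omega> \<in> B then C1 \<omega> else C2 \<omega>) \<in> M \<rightarrow>\<^sub>M count_space T"
    using B measurable_count_space_mono[OF C1 T(2)] measurable_count_space_mono[OF C2 T(3)]
    by (intro measurable_If_set) auto
  then have Cmeas: "C \<in> M \<rightarrow>\<^sub>M count_space T"
    using C by (simp cong: measurable_cong)
  \<comment> \<open>\<open>u \<eta>\<close> and \<open>v \<eta>\<close> are the contributions of the
    two branches to the probability of \<open>P = \<eta>\<close>. Where their sum is positive,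
    \<open>u \<eta> / (u \<eta> + v \<eta>)\<close> is the conditional probability that the branch
    \<open>P1\<close> was chosen.\<close>
  define u where "u \<eta> = p * prob {\<omega> \<in> space M. P1 \<omega> = \<eta>}" for \<eta>
  define v where "v \<eta> = (1 - p) * prob {\<omega> \<in> space M. P2 \<omega> = \<eta>}" for \<eta>
  have uv: "0 \<le> u \<eta>" "0 \<le> v \<eta>" for \<eta>
    using p by (auto simp: u_def v_def)
  \<comment> \<open>The choice is meaningful exactly on the hull of \<open>T\<close>, where
    \<open>ex_convex_weights\<close> supplies coefficients.\<close>
  define w where "w \<eta> = (SOME w. convex_weights T w \<eta>)" for \<eta>
  define g where "g s \<eta> =
    (if u \<eta> + v \<eta> = 0 then w \<eta> s else (u \<eta> * a s \<eta> + v \<eta> * b s \<eta>) / (u \<eta> + v \<eta>))" for s \<eta>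
  have "convex_weights T (\<lambda>s. g s \<eta>) \<eta>" if "\<eta> \<in> convex hull T" for \<eta>
  proof (cases "u \<eta> + v \<eta> = 0")
    case True
    then show ?thesis
      using someI_ex[OF ex_convex_weights[OF T(1) that]] by (simp add: g_def w_def)
  next
    case False
    \<comment> \<open>Positive mass under \<open>P1\<close> places \<open>\<eta>\<close> in the hull
      of \<open>T1\<close>, where \<open>a\<close> is a valid choice; it extends by zero to
      \<open>T\<close>.\<close>
    have "convex_weights T (\<lambda>s. a s \<eta>) \<eta>" if "u \<eta> \<noteq> 0"
    proof (rule convex_weights_mono[OF a(1) T(1,2) a(2)])
      show "\<eta> \<in> convex hull T1"
        using AE_prob_nonzero[OF P1(2)] that by (auto simp: u_def)
    qed
    moreover have "convex_weights T (\<lambda>s. b s \<eta>) \<eta>" if "v \<eta> \<noteq> 0"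
    proof (rule convex_weights_mono[OF b(1) T(1,3) b(2)])
      show "\<eta> \<in> convex hull T2"
        using AE_prob_nonzero[OF P2(2)] that by (auto simp: v_def)
    qed
    ultimately have "convex_weights T (\<lambda>s. (u \<eta> * a s \<eta> + v \<eta> * b s \<eta>) / (u \<eta> + v \<eta>)) \<eta>"
      using uv False by (intro convex_weights_average)
    with False show ?thesis
      by (simp add: g_def)
  qed
  moreover have "prob {\<omega> \<in> space M. C \<omega> = s} = expectation (\<lambda>\<omega>. g s (P \<omega>))" for s
  proof -
    \<comment> \<open>Clearing the denominator is also valid at zero mass: \<open>u \<eta>\<close>
      and \<open>v \<eta>\<close> are nonnegative, so they vanish together and both sides are 0.
      This makes the expectation under \<open>P\<close> split into the two branches.\<close>
    have g: "g s \<eta> * (u \<eta> + v \<eta>) = u \<eta> * a s \<eta> + v \<eta> * b s \<eta>" for \<eta>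
    proof (cases "u \<eta> + v \<eta> = 0")
      case True
      then have "u \<eta> = 0" "v \<eta> = 0"
        using uv[of \<eta>] by linarith+
      then show ?thesis
        by simp
    qed (simp add: g_def)
    have "expectation (\<lambda>\<omega>. g s (P \<omega>)) = (\<Sum>\<eta>\<in>F. g s \<eta> * (u \<eta> + v \<eta>))"
      using finitely_supported_expectation(2)[OF Pfin finF, of "g s"] AE_P
      by (auto simp: probP u_def v_def)
    also have "\<dots> = p * (\<Sum>\<eta>\<in>F. a s \<eta> * prob {\<omega> \<in> space M. P1 \<omega> = \<eta>})
        + (1 - p) * (\<Sum>\<eta>\<in>F. b s \<eta> * prob {\<omega> \<in> space M. P2 \<omega> = \<eta>})"
      unfolding g by (simp add: u_def v_def sum.distrib sum_distrib_left mult_ac)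
    also have "\<dots> = p * expectation (\<lambda>\<omega>. a s (P1 \<omega>)) + (1 - p) * expectation (\<lambda>\<omega>. b s (P2 \<omega>))"
      by (simp add: finitely_supported_expectation(2)[OF P1(1) finF AE_F(1)]
          finitely_supported_expectation(2)[OF P2(1) finF AE_F(2)])
    finally show ?thesis
      by (simp add: probC prob1 prob2)
  qed
  ultimately show ?thesis
    using T(1) Pfin AE_P Cmeas by (intro weights_imp_survey[of T g]) auto
qed

end

theorem theorem3:
  fixes M :: "'a measure"
    and basis :: "'v::real_vector set"
    and P1 P2 P C1 C2 C :: "'a \<Rightarrow> 'v"
    and p :: real
  assumes "prob_space M"
    and "finite basis" and "span basis = UNIV"
    and "finitely_supported M P1" and "finitely_supported M P2"
    and "prob_space.indep_var M (count_space UNIV) P1 (count_space UNIV) P2"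
    and "survey M C1 P1" and "survey M C2 P2"
    and "p \<in> {0..1}"
    and "mixture_of M p P1 P2 P"
    and "mixture_of M p C1 C2 C"
  shows "survey M C P"
  using prob_space.survey_mixture[OF assms(1,7-11)] .

end
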